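(* Let $S_n=(V_n,E_n)$ be the star graph with $V_n=\{0,1,\dots,n\}$ and $E_n=\{(0,x): x=1,2,\dots,n\}$. Then the propagation ratio satisfies $$\lim_{n\to\infty}\mathcal{R}(S_n)=2 .$$
   Context: Rumor propagation process on a finite graph $G=(V,E)$ with $m=|V|$ sites: there are $m$ distinct informations, one initially known by each site (each site initially knows only its own information). Let $i_x(t)$ denote the set of informations known by site $x$ at time $t\in\{0,1,2,\dots\}$. At each time $t$ an edge $e_{xy}\in E$ (joining $x$ and $y$) is selected uniformly at random from $E$, independently of the past, and then $i_x(t+1)=i_y(t+1)=i_x(t)\cup i_y(t)$, while $i_z(t+1)=i_z(t)$ for $z\ne x,y$. The total propagation time $\tau_V$ is the first time $t$ at which every site knows all $m$ informations. For $x\in V$, $\tau_x$ is the first time $t$ at which every site knows the information initially known by $x$. The propagation ratio of $G$ is $$\mathcal{R}(G)=\frac{\mathbb{E}\,\tau_V}{\min_{x\in V}\mathbb{E}\,\tau_x}.$$ *)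

theory Defs
  imports "HOL-Probability.Probability"
begin

text \<open>A finite simple graph is given by its vertex set \<open>V\<close> and its edge set \<open>E\<close>; the edge joining
  \<open>x\<close> and \<open>y\<close> is the two-element set \<open>{x, y}\<close>. The information initially known by site \<open>x\<close> is
  identified with \<open>x\<close> itself.\<close>

definition is_graph :: "'a set \<Rightarrow> 'a set set \<Rightarrow> bool" where
  "is_graph V E \<longleftrightarrow> finite V \<and> (\<forall>e\<in>E. e \<subseteq> V \<and> card e = 2)"

definition exchange :: "'a set \<Rightarrow> ('a \<Rightarrow> 'a set) \<Rightarrow> 'a \<Rightarrow> 'a set" where
  "exchange e i = (\<lambda>z. if z \<in> e then (\<Union>y\<in>e. i y) else i z)"

lemma exchange_edge:
  "exchange {x, y} i z = (if z = x \<or> z = y then i x \<union> i y else i z)"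
  by (auto simp: exchange_def)

text \<open>\<open>known \<omega> t x\<close> is $i_x(t)$ when \<open>\<omega> !! s\<close> is the edge selected at time \<open>s\<close>.\<close>

primrec known :: "'a set stream \<Rightarrow> nat \<Rightarrow> 'a \<Rightarrow> 'a set" where
  "known \<omega> 0 = (\<lambda>x. {x})"
| "known \<omega> (Suc t) = exchange (\<omega> !! t) (known \<omega> t)"

text \<open>The infimum is \<open>\<infinity>\<close> if the event never happens.\<close>

definition first_time :: "(nat \<Rightarrow> bool) \<Rightarrow> enat" where
  "first_time P = Inf (enat ` {t. P t})"

definition total_propagation_time :: "'a set \<Rightarrow> 'a set stream \<Rightarrow> enat" where
  "total_propagation_time V \<omega> = first_time (\<lambda>t. \<forall>y\<in>V. V \<subseteq> known \<omega> t y)"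

definition site_propagation_time :: "'a set \<Rightarrow> 'a \<Rightarrow> 'a set stream \<Rightarrow> enat" where
  "site_propagation_time V x \<omega> = first_time (\<lambda>t. \<forall>y\<in>V. x \<in> known \<omega> t y)"

text \<open>The law of a sequence of independent edges, each uniform on \<open>E\<close> (a probability measure whenever
  \<open>E\<close> is finite and nonempty).\<close>

definition edge_process :: "'a set set \<Rightarrow> 'a set stream measure" where
  "edge_process E = stream_space (uniform_count_measure E)"

definition expected_time :: "'a set set \<Rightarrow> ('a set stream \<Rightarrow> enat) \<Rightarrow> ennreal" where
  "expected_time E \<tau> = (\<integral>\<^sup>+ \<omega>. ennreal_of_enat (\<tau> \<omega>) \<partial>edge_process E)"

text \<open>In \<^typ>\<open>ennreal\<close>, \<open>\<infinity> / \<infinity> = 0 / 0 = 0\<close>, and \<open>a / 0 = \<infinity>\<close> for \<open>a > 0\<close>. Hence a ratio in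
  the open interval from \<open>0\<close> to \<open>\<infinity>\<close> is always a quotient of two finite positive expectations.\<close>

definition propagation_ratio :: "'a set \<Rightarrow> 'a set set \<Rightarrow> ennreal" where
  "propagation_ratio V E =
     expected_time E (total_propagation_time V) /
     (MIN x\<in>V. expected_time E (site_propagation_time V x))"

definition star_verts :: "nat \<Rightarrow> nat set" where
  "star_verts n = {0..n}"

definition star_edges :: "nat \<Rightarrow> nat set set" where
  "star_edges n = {{0, x} | x. x \<in> {1..n}}"

lemma is_graph_star: "is_graph (star_verts n) (star_edges n)"
  by (auto simp: is_graph_def star_verts_def star_edges_def card_insert_if)

end

theory Submission
  imports Defs
begin

text \<open>
  Both propagation times of the star are coupon collector times. An information reaches all leaves
  only through the hub \<open>0\<close>, and selecting an edge amounts to selecting a leaf.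

  The hub's information spreads to exactly the leaves selected so far, so its time is the time to
  collect \<open>n\<close> coupons, with expectation \<open>n H\<^sub>n\<close>, where \<open>H\<^sub>n\<close> is the harmonic number. On every
  realisation, no leaf's information is faster: once it is everywhere, every leaf has been selected
  (\<open>leaf_known_imp_hub_known\<close>). Hence the minimum in the ratio is \<open>n H\<^sub>n\<close>.

  Total propagation runs through two collections in succession. During the first, the hub collects
  the informations of the \<open>n\<close> leaves. No site knows everything before its end, and at its end the
  hub and the leaf selected last do. During the second, the remaining \<open>n - 1\<close> leaves must each be
  selected once more. So the expectation is \<open>n H\<^sub>n + n H\<^sub>n\<^sub>-\<^sub>1 = 2 n H\<^sub>n - 1\<close>, and the ratio
  is \<open>2 - 1 / (n H\<^sub>n)\<close>, with limit \<open>2\<close>.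

  Both expectations come from one principle, \<open>expected_hit\<close>: if each step of a chain lowers an
  integer level by at most one, and does so on exactly \<open>c l\<close> of the \<open>N\<close> equally likely inputs when
  the level is \<open>l\<close>, then the expected time to descend from level \<open>L\<close> to \<open>0\<close> is the sum of the
  \<open>N / c j\<close> over \<open>1 \<le> j \<le> L\<close>, since the time spent on each level is geometric.
\<close>

section \<open>Geometric recurrences\<close>

text \<open>If \<open>a t\<close> and \<open>b t\<close> are the tails of the hitting times from a level and from the level below it,
  and \<open>p\<close> is the probability to descend, conditioning on the first step gives this recurrence.
  Summed over \<open>t\<close> it telescopes. The explicit partial sums show both that the series converges and
  what its value is, so finiteness of the expectation need not be known in advance.\<close>

lemma sums_lazy_recurrence:
  fixes a b :: "nat \<Rightarrow> real"
  assumes p: "0 < p" and a: "\<And>t. 0 \<le> a t" and b: "\<And>t. 0 \<le> b t"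
    and rec: "\<And>t. a (Suc t) = p * b t + (1 - p) * a t" and B: "b sums B"
  shows "a sums (a 0 / p + B)"
proof -
  have partial: "(\<Sum>t<N. a t) = (a 0 - a N) / p + (\<Sum>t<N. b t)" for N
    using p by (induction N) (simp_all add: rec field_simps)
  have "(\<Sum>t<N. a t) \<le> a 0 / p + B" for N
  proof -
    have "(\<Sum>t<N. b t) \<le> B"
      using B b by (metis sum_le_suminf sums_iff finite_lessThan)
    moreover have "(a 0 - a N) / p \<le> a 0 / p"
      using p a[of N] by (simp add: divide_right_mono)
    ultimately show ?thesis
      by (simp add: partial)
  qed
  then have "summable a"
    using a by (intro summableI_nonneg_bounded)
  then have "a \<longlonglongrightarrow> 0"
    by (rule summable_LIMSEQ_zero)
  then have "(\<lambda>N. (a 0 - a N) / p + (\<Sum>t<N. b t)) \<longlonglongrightarrow> (a 0 - 0) / p + B"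
    using p B by (intro tendsto_intros) (auto simp: sums_def)
  then show ?thesis
    by (simp add: sums_def partial)
qed

section \<open>Hitting times of chains that descend one level at a time\<close>

lemma less_first_time_iff: "enat t < first_time P \<longleftrightarrow> (\<forall>r\<le>t. \<not> P r)"
proof
  assume "enat t < first_time P"
  then show "\<forall>r\<le>t. \<not> P r"
    unfolding first_time_def
    by (metis (mono_tags, lifting) Inf_lower image_eqI mem_Collect_eq leD enat_ord_simps(1) order_less_le_trans)
next
  assume "\<forall>r\<le>t. \<not> P r"
  then have "enat (Suc t) \<le> first_time P"
    unfolding first_time_def by (intro Inf_greatest) (auto simp: not_less_eq_eq[symmetric])
  then show "enat t < first_time P"
    by (simp add: Suc_ile_eq)
qed

lemma less_first_time_Suc_iff:
  "enat (Suc t) < first_time P \<longleftrightarrow> \<not> P 0 \<and> enat t < first_time (\<lambda>t. P (Suc t))"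
  unfolding less_first_time_iff by (metis le0 Suc_le_mono not0_implies_Suc)

primrec run :: "('s \<Rightarrow> 'e \<Rightarrow> 's) \<Rightarrow> 's \<Rightarrow> 'e stream \<Rightarrow> nat \<Rightarrow> 's" where
  "run \<delta> s \<omega> 0 = s"
| "run \<delta> s \<omega> (Suc t) = \<delta> (run \<delta> s \<omega> t) (\<omega> !! t)"

lemma run_Suc_shift: "run \<delta> s \<omega> (Suc t) = run \<delta> (\<delta> s (shd \<omega>)) (stl \<omega>) t"
  by (induction t) simp_all

text \<open>The state after \<open>t\<close> steps is a function of the first \<open>t\<close> inputs, and these take only countably many
  values. So the state space can carry the discrete \<open>\<sigma>\<close>-algebra, even when it is uncountable.\<close>

lemma measurable_run:
  assumes "countable E" and M: "sets M = Pow E"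
  shows "(\<lambda>\<omega>. run \<delta> s \<omega> t) \<in> stream_space M \<rightarrow>\<^sub>M count_space UNIV"
proof (induction t arbitrary: s)
  case 0
  then show ?case by simp
next
  case (Suc t)
  have [measurable_cong]: "sets M = sets (count_space E)"
    by (simp add: M)
  have "(\<lambda>\<omega>. run \<delta> (\<delta> s (shd \<omega>)) (stl \<omega>) t) \<in> stream_space M \<rightarrow>\<^sub>M count_space UNIV"
  proof (rule measurable_compose_countable'[where I = E])
    show "(\<lambda>\<omega>. run \<delta> (\<delta> s e) (stl \<omega>) t) \<in> stream_space M \<rightarrow>\<^sub>M count_space UNIV" for e
      by (rule measurable_compose[OF measurable_stl Suc])
    show "shd \<in> stream_space M \<rightarrow>\<^sub>M count_space E"
      by measurable
  qed fact
  then show ?case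
    by (simp add: run_Suc_shift del: run.simps)
qed

lemma measurable_first_time:
  assumes [measurable]: "\<And>t. Measurable.pred M (\<lambda>\<omega>. P \<omega> t)"
  shows "(\<lambda>\<omega>. first_time (P \<omega>)) \<in> M \<rightarrow>\<^sub>M count_space UNIV"
proof -
  have "first_time (P \<omega>) = (INF t. if P \<omega> t then enat t else \<infinity>)" for \<omega>
    unfolding first_time_def
    by (rule antisym) (auto intro!: INF_greatest Inf_greatest intro: Inf_lower INF_lower2)
  moreover have "(\<lambda>\<omega>. INF t. if P \<omega> t then enat t else \<infinity>) \<in> M \<rightarrow>\<^sub>M count_space UNIV"
    by measurable
  ultimately show ?thesis
    by simp
qed

text \<open>The transition structure is required only on states satisfying an invariant, so that a chain can
  live on a type with many unreachable states. Which inputs lower the level may depend on the state;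
  how many do depends only on the level.\<close>

locale level_chain =
  fixes E :: "'e set" and \<delta> :: "'s \<Rightarrow> 'e \<Rightarrow> 's" and inv :: "'s \<Rightarrow> bool"
    and level :: "'s \<Rightarrow> nat" and c :: "nat \<Rightarrow> nat"
  assumes finite_E: "finite E" and E_ne: "E \<noteq> {}"
    and inv_step: "\<And>s e. inv s \<Longrightarrow> e \<in> E \<Longrightarrow> inv (\<delta> s e)"
    and level_step:
      "\<And>s e l. inv s \<Longrightarrow> e \<in> E \<Longrightarrow> level s = Suc l \<Longrightarrow> level (\<delta> s e) = l \<or> level (\<delta> s e) = Suc l"
    and card_descents:
      "\<And>s l. inv s \<Longrightarrow> level s = Suc l \<Longrightarrow> card {e \<in> E. level (\<delta> s e) = l} = c (Suc l)"
begin

abbreviation \<Omega> :: "'e stream measure" where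
  "\<Omega> \<equiv> stream_space (uniform_count_measure E)"

definition hit :: "'s \<Rightarrow> 'e stream \<Rightarrow> enat" where
  "hit s \<omega> = first_time (\<lambda>t. level (run \<delta> s \<omega> t) = 0)"

text \<open>The tail of the hitting time of level \<open>0\<close> from level \<open>l\<close>, as given by conditioning on the first
  step.\<close>

primrec tail :: "nat \<Rightarrow> nat \<Rightarrow> real" where
  "tail 0 l = of_bool (0 < l)"
| "tail (Suc t) l = (case l of 0 \<Rightarrow> 0 | Suc k \<Rightarrow>
     c l / card E * tail t k + (1 - c l / card E) * tail t l)"

lemma hit_measurable [measurable]: "hit s \<in> \<Omega> \<rightarrow>\<^sub>M count_space UNIV"
proof -
  have [measurable]: "(\<lambda>\<omega>. run \<delta> s \<omega> t) \<in> \<Omega> \<rightarrow>\<^sub>M count_space UNIV" for t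
    by (rule measurable_run[of E])
       (simp_all add: finite_E countable_finite sets_uniform_count_measure)
  show ?thesis
    unfolding hit_def by (rule measurable_first_time) measurable
qed

lemma Suc_less_hit_iff:
  "enat (Suc t) < hit s (e ## \<omega>) \<longleftrightarrow> level s \<noteq> 0 \<and> enat t < hit (\<delta> s e) \<omega>"
  unfolding hit_def less_first_time_Suc_iff run_Suc_shift by simp

lemma card_E_pos: "0 < card E"
  using finite_E E_ne by (simp add: card_gt_0_iff)

text \<open>The law of the hitting time depends on the state only through its level. Conditioning on the first
  input turns the tail at \<open>t + 1\<close> into the average of the tails at \<open>t\<close> over the next states, of which
  \<open>c (l + 1)\<close> have level \<open>l\<close> and the others the same level as before. Nonnegativity of \<open>tail\<close> is
  part of the induction because it allows this average to be formed in \<^typ>\<open>real\<close>.\<close>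

lemma prob_hit_gt:
  "inv s \<Longrightarrow> emeasure \<Omega> {\<omega> \<in> space \<Omega>. enat t < hit s \<omega>} = ennreal (tail t (level s)) \<and>
     0 \<le> tail t (level s)"
proof (induction t arbitrary: s)
  case 0
  interpret U: prob_space "uniform_count_measure E"
    by (rule prob_space_uniform_count_measure) (fact finite_E E_ne)+
  interpret prob_space \<Omega>
    by (rule U.prob_space_stream_space)
  have "{\<omega> \<in> space \<Omega>. enat 0 < hit s \<omega>} = (if level s = 0 then {} else space \<Omega>)"
    by (auto simp: hit_def less_first_time_iff)
  then show ?case
    by (simp add: emeasure_space_1)
next
  case (Suc t)
  interpret U: prob_space "uniform_count_measure E"
    by (rule prob_space_uniform_count_measure) (fact finite_E E_ne)+
  show ?case
  proof (cases "level s")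
    case 0
    then have "{\<omega> \<in> space \<Omega>. enat (Suc t) < hit s \<omega>} = {}"
      by (auto simp: hit_def less_first_time_iff)
    then show ?thesis
      by (simp add: 0 del: Collect_empty_eq)
  next
    case (Suc l)
    let ?A = "\<lambda>t s. {\<omega> \<in> space \<Omega>. enat t < hit s \<omega>}"
    let ?D = "{e \<in> E. level (\<delta> s e) = l}"
    have D: "real (card ?D) = c (Suc l)" "?D \<subseteq> E"
      using card_descents[OF Suc.prems Suc] by auto
    have nonneg: "0 \<le> tail t (level (\<delta> s e))" if "e \<in> E" for e
      using Suc.IH[OF inv_step[OF Suc.prems that]] by simp
    have "emeasure \<Omega> (?A (Suc t) s) =
        (\<integral>\<^sup>+ e. emeasure \<Omega> {\<omega> \<in> space \<Omega>. e ## \<omega> \<in> ?A (Suc t) s} \<partial>uniform_count_measure E)"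
      by (rule U.emeasure_stream_space) measurable
    also have "\<dots> = (\<integral>\<^sup>+ e. emeasure \<Omega> (?A t (\<delta> s e)) \<partial>uniform_count_measure E)"
      by (intro nn_integral_cong arg_cong[where f = "emeasure \<Omega>"])
         (auto simp: Suc_less_hit_iff Suc stream_space_Stream)
    also have "\<dots> = (\<integral>\<^sup>+ e. ennreal (tail t (level (\<delta> s e))) \<partial>uniform_count_measure E)"
      using Suc.IH inv_step Suc.prems
      by (intro nn_integral_cong) (simp add: space_uniform_count_measure)
    also have "\<dots> = (\<Sum>e\<in>E. ennreal (1 / card E) * ennreal (tail t (level (\<delta> s e))))"
      unfolding uniform_count_measure_def
      by (simp add: nn_integral_point_measure_finite finite_E)
    also have "\<dots> = (\<Sum>e\<in>E. ennreal (1 / card E * tail t (level (\<delta> s e))))"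
      by (intro sum.cong refl ennreal_mult'[symmetric]) (simp add: nonneg)
    also have "\<dots> = ennreal (\<Sum>e\<in>E. 1 / card E * tail t (level (\<delta> s e)))"
      by (intro sum_ennreal) (simp add: nonneg)
    also have eq: "(\<Sum>e\<in>E. 1 / card E * tail t (level (\<delta> s e))) = tail (Suc t) (level s)"
    proof -
      have "(\<Sum>e\<in>E. tail t (level (\<delta> s e))) =
          (\<Sum>e\<in>?D. tail t (level (\<delta> s e))) + (\<Sum>e\<in>E - ?D. tail t (level (\<delta> s e)))"
        by (subst sum.subset_diff[OF D(2) finite_E]) simp
      also have "(\<Sum>e\<in>?D. tail t (level (\<delta> s e))) = c (Suc l) * tail t l"
        by (simp add: D(1))
      also have "(\<Sum>e\<in>E - ?D. tail t (level (\<delta> s e))) = (\<Sum>e\<in>E - ?D. tail t (Suc l))"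
        using level_step[OF Suc.prems _ Suc] by (intro sum.cong refl) (metis (mono_tags, lifting) DiffE mem_Collect_eq)
      also have "\<dots> = (real (card E) - real (c (Suc l))) * tail t (Suc l)"
        using D finite_E card_mono[OF finite_E D(2)]
        by (simp add: card_Diff_subset finite_subset)
      finally have "(\<Sum>e\<in>E. 1 / card E * tail t (level (\<delta> s e))) =
          1 / card E * (c (Suc l) * tail t l + (real (card E) - real (c (Suc l))) * tail t (Suc l))"
        by (simp add: sum_divide_distrib[symmetric])
      also have "\<dots> = tail (Suc t) (level s)"
        using card_E_pos by (simp add: Suc field_simps)
      finally show ?thesis .
    qed
    finally have "emeasure \<Omega> (?A (Suc t) s) = ennreal (tail (Suc t) (level s))" .
    moreover have "0 \<le> tail (Suc t) (level s)"
      unfolding eq[symmetric] by (intro sum_nonneg) (simp add: nonneg)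
    ultimately show ?thesis
      by simp
  qed
qed

lemma tail_sums:
  assumes "\<And>j. 1 \<le> j \<Longrightarrow> j \<le> l \<Longrightarrow> 0 < c j \<and> c j \<le> card E"
  shows "(\<lambda>t. tail t l) sums (\<Sum>j=1..l. card E / c j)" and "0 \<le> tail t l"
proof -
  have "(\<lambda>t. tail t l) sums (\<Sum>j=1..l. card E / c j) \<and> (\<forall>t. 0 \<le> tail t l)"
    using assms
  proof (induction l)
    case 0
    have "tail t 0 = 0" for t
      by (cases t) simp_all
    then show ?case
      by simp
  next
    case (Suc l)
    let ?p = "c (Suc l) / card E"
    have p: "0 < ?p" "?p \<le> 1"
      using Suc.prems[of "Suc l"] card_E_pos by auto
    have IH: "(\<lambda>t. tail t l) sums (\<Sum>j=1..l. card E / c j)" "\<And>t. 0 \<le> tail t l"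
      using Suc by auto
    have nonneg: "0 \<le> tail t (Suc l)" for t
      using p IH(2) by (induction t) simp_all
    have "(\<lambda>t. tail t (Suc l)) sums (tail 0 (Suc l) / ?p + (\<Sum>j=1..l. card E / c j))"
      by (rule sums_lazy_recurrence[OF p(1) nonneg IH(2) _ IH(1)]) simp
    then show ?case
      using nonneg by (simp add: add.commute)
  qed
  then show "(\<lambda>t. tail t l) sums (\<Sum>j=1..l. card E / c j)" and "0 \<le> tail t l"
    by auto
qed

theorem expected_hit:
  assumes "inv s" and "\<And>j. 1 \<le> j \<Longrightarrow> j \<le> level s \<Longrightarrow> 0 < c j \<and> c j \<le> card E"
  shows "(\<integral>\<^sup>+ \<omega>. ennreal_of_enat (hit s \<omega>) \<partial>\<Omega>) = ennreal (\<Sum>j=1..level s. card E / c j)"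
proof -
  have "(\<integral>\<^sup>+ \<omega>. ennreal_of_enat (hit s \<omega>) \<partial>\<Omega>) = (\<Sum>t. ennreal (tail t (level s)))"
    by (simp add: nn_integral_enat_function prob_hit_gt[OF assms(1)])
  also have "\<dots> = ennreal (\<Sum>j=1..level s. card E / c j)"
    using tail_sums[OF assms(2)] by (intro suminf_ennreal_eq) auto
  finally show ?thesis .
qed

end

section \<open>Knowledge on the star\<close>

definition uninformed :: "nat \<Rightarrow> (nat \<Rightarrow> nat set) \<Rightarrow> nat set" where
  "uninformed n i = {x \<in> {1..n}. 0 \<notin> i x}"

definition incomplete :: "nat \<Rightarrow> (nat \<Rightarrow> nat set) \<Rightarrow> nat set" where
  "incomplete n i = {x \<in> {1..n}. \<not> star_verts n \<subseteq> i x}"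

text \<open>What holds along every realisation. A leaf has been selected exactly if it knows the hub's
  information; after that the hub knows the leaf's information, and before that the leaf and the rest
  of the graph have exchanged nothing. The last clause holds because the leaf whose selection completes
  the hub becomes complete at the same moment. It is the reason why the second phase of total
  propagation has \<open>n - 1\<close> rather than \<open>n\<close> leaves to collect.\<close>

definition star_inv :: "nat \<Rightarrow> (nat \<Rightarrow> nat set) \<Rightarrow> bool" where
  "star_inv n i \<longleftrightarrow> 0 \<in> i 0 \<and>
     (\<forall>x\<in>{1..n}. x \<in> i x \<and> (0 \<in> i x \<longrightarrow> x \<in> i 0) \<and>
       (0 \<notin> i x \<longrightarrow> i x = {x} \<and> (\<forall>z\<in>star_verts n - {x}. x \<notin> i z))) \<and>
     (uninformed n i = {} \<longrightarrow> incomplete n i \<noteq> {1..n})"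

lemma star_edgeE:
  assumes "e \<in> star_edges n"
  obtains w where "e = {0, w}" "w \<in> {1..n}"
  using assms by (auto simp: star_edges_def)

lemma star_edges_image: "star_edges n = (\<lambda>x. {0, x}) ` {1..n}"
  by (auto simp: star_edges_def)

lemma inj_on_star_edge: "inj_on (\<lambda>x. {0, x}) {1..n::nat}"
  by (auto simp: inj_on_def doubleton_eq_iff)

lemma card_star_edges_filter:
  "card {e \<in> star_edges n. P e} = card {x \<in> {1..n}. P {0, x}}"
proof -
  have "{e \<in> star_edges n. P e} = (\<lambda>x. {0, x}) ` {x \<in> {1..n}. P {0, x}}"
    by (auto simp: star_edges_image)
  moreover have "inj_on (\<lambda>x. {0, x}) {x \<in> {1..n}. P {0, x}}"
    by (rule inj_on_subset[OF inj_on_star_edge]) blast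
  ultimately show ?thesis
    by (simp only: card_image)
qed

lemma card_star_edges: "card (star_edges n) = n"
  unfolding star_edges_image by (subst card_image[OF inj_on_star_edge]) simp

lemma finite_star_edges: "finite (star_edges n)"
  by (simp add: star_edges_image)

lemma star_verts_eq: "star_verts n = insert 0 {1..n}"
  by (auto simp: star_verts_def)

lemma finite_uninformed [simp]: "finite (uninformed n i)"
  and finite_incomplete [simp]: "finite (incomplete n i)"
  by (simp_all add: uninformed_def incomplete_def)

lemma uninformed_initial: "uninformed n (\<lambda>x. {x}) = {1..n}"
  by (auto simp: uninformed_def)

lemma uninformed_exchange:
  assumes "star_inv n i" "w \<in> {1..n}"
  shows "uninformed n (exchange {0, w} i) = uninformed n i - {w}"
  using assms by (auto simp: uninformed_def exchange_edge star_inv_def)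

lemma hub_and_last_leaf_complete:
  assumes "star_inv n i" "uninformed n i \<subseteq> {w}" "w \<in> {1..n}"
  shows "star_verts n \<subseteq> i 0 \<union> i w"
proof
  fix x assume "x \<in> star_verts n"
  then consider "x = 0" | "x = w" | "x \<in> {1..n}" "x \<noteq> w"
    unfolding star_verts_eq by blast
  then show "x \<in> i 0 \<union> i w"
  proof cases
    case 3
    then have "0 \<in> i x"
      using assms(2) by (auto simp: uninformed_def)
    then show ?thesis
      using assms(1) 3 by (simp add: star_inv_def)
  qed (use assms in \<open>simp_all add: star_inv_def\<close>)
qed

lemma hub_complete:
  assumes "star_inv n i" "uninformed n i = {}"
  shows "star_verts n \<subseteq> i 0"
proof
  fix x assume x: "x \<in> star_verts n"
  show "x \<in> i 0"
  proof (cases "x = 0")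
    case False
    then have "x \<in> {1..n}"
      using x by (simp add: star_verts_eq)
    moreover from this have "0 \<in> i x"
      using assms(2) unfolding uninformed_def by blast
    ultimately show ?thesis
      using assms(1) by (simp add: star_inv_def)
  qed (use assms(1) in \<open>simp add: star_inv_def\<close>)
qed

text \<open>The information of a leaf that was never selected is missing at all other leaves, and that leaf
  itself misses the hub's information.\<close>

lemma incomplete_eq_leaves:
  assumes "star_inv n i" "uninformed n i \<noteq> {}"
  shows "incomplete n i = {1..n}"
proof -
  obtain y where y: "y \<in> {1..n}" "0 \<notin> i y"
    using assms(2) unfolding uninformed_def by blast
  have V: "0 \<in> star_verts n" "y \<in> star_verts n"
    using y(1) by (auto simp: star_verts_def)
  have "\<not> star_verts n \<subseteq> i x" if "x \<in> {1..n}" for x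
  proof (cases "x = y")
    case False
    have "x \<in> star_verts n"
      using that by (simp add: star_verts_def)
    then have "y \<notin> i x"
      using assms(1) y False unfolding star_inv_def by blast
    then show ?thesis
      using V by blast
  qed (use y V in blast)
  then show ?thesis
    unfolding incomplete_def by blast
qed

text \<open>In the second phase, including the step which completes the first one, the exchange leaves the
  hub complete, so that it completes the selected leaf.\<close>

lemma incomplete_exchange:
  assumes "star_inv n i" "w \<in> {1..n}" "uninformed n i \<subseteq> {w}"
  shows "incomplete n (exchange {0, w} i) = incomplete n i - {w}"
  using hub_and_last_leaf_complete[OF assms(1,3,2)] assms(2)
  by (auto simp: incomplete_def exchange_edge)

lemma star_inv_step:
  assumes inv: "star_inv n i" and w: "w \<in> {1..n}"
  shows "star_inv n (exchange {0, w} i)"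
proof -
  have "incomplete n (exchange {0, w} i) \<noteq> {1..n}" if "uninformed n (exchange {0, w} i) = {}"
  proof -
    have "uninformed n i \<subseteq> {w}"
      using that by (simp add: uninformed_exchange[OF inv w])
    then show ?thesis
      using incomplete_exchange[OF inv w] w by blast
  qed
  moreover have "0 \<in> exchange {0, w} i 0"
    using inv by (simp add: exchange_edge star_inv_def)
  moreover have "x \<in> exchange {0, w} i x \<and> (0 \<in> exchange {0, w} i x \<longrightarrow> x \<in> exchange {0, w} i 0) \<and>
       (0 \<notin> exchange {0, w} i x \<longrightarrow> exchange {0, w} i x = {x} \<and>
        (\<forall>z\<in>star_verts n - {x}. x \<notin> exchange {0, w} i z))" if "x \<in> {1..n}" for x
  proof -
    have w0: "w \<noteq> 0" and x0: "x \<noteq> 0" and V: "0 \<in> star_verts n" "w \<in> star_verts n"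
      using w that by (auto simp: star_verts_def)
    have "0 \<in> i 0" and w_self: "w \<in> i w"
      using inv w by (simp_all only: star_inv_def)
    show ?thesis
    proof (cases "x = w")
      case True
      then show ?thesis
        using \<open>0 \<in> i 0\<close> w_self by (simp add: exchange_edge)
    next
      case False
      have "x \<in> i x" "0 \<in> i x \<Longrightarrow> x \<in> i 0"
        and "0 \<notin> i x \<Longrightarrow> i x = {x}"
        and "0 \<notin> i x \<Longrightarrow> z \<in> star_verts n \<Longrightarrow> z \<noteq> x \<Longrightarrow> x \<notin> i z" for z
        using inv that unfolding star_inv_def by blast+
      then show ?thesis
        using False x0 V by (auto simp: exchange_edge)
    qed
  qed
  ultimately show ?thesis
    unfolding star_inv_def by blast
qed

lemma star_inv_step_edge:
  assumes "star_inv n i" "e \<in> star_edges n"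
  shows "star_inv n (exchange e i)"
  using assms(2) by (elim star_edgeE) (simp only: star_inv_step[OF assms(1)])

lemma star_inv_initial: "1 \<le> n \<Longrightarrow> star_inv n (\<lambda>x. {x})"
  by (auto simp: star_inv_def uninformed_def)

lemma known_eq_run: "known \<omega> t = run (\<lambda>i e. exchange e i) (\<lambda>x. {x}) \<omega> t"
  by (induction t) simp_all

lemma star_inv_known:
  assumes "1 \<le> n" "\<omega> \<in> space (edge_process (star_edges n))"
  shows "star_inv n (known \<omega> t)"
proof (induction t)
  case 0
  show ?case
    using star_inv_initial[OF assms(1)] by simp
next
  case (Suc t)
  have "\<omega> !! t \<in> star_edges n"
    using assms(2)
    by (auto simp: edge_process_def space_stream_space space_uniform_count_measure streams_iff_snth)
  then show ?case
    using Suc by (simp add: star_inv_step_edge)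
qed

lemma hub_known_iff:
  assumes "star_inv n i"
  shows "(\<forall>y\<in>star_verts n. 0 \<in> i y) \<longleftrightarrow> uninformed n i = {}"
  using assms by (auto simp: star_inv_def star_verts_eq uninformed_def)

text \<open>A leaf that has not been selected knows only itself, and is known only to itself. So a leaf's
  information cannot be everywhere while some leaf is still unselected.\<close>

lemma leaf_known_imp_hub_known:
  assumes "star_inv n i" "x \<in> star_verts n" "\<forall>y\<in>star_verts n. x \<in> i y"
  shows "\<forall>y\<in>star_verts n. 0 \<in> i y"
proof (cases "x = 0")
  case False
  then have x: "x \<in> {1..n}" and 0: "0 \<in> star_verts n"
    using assms(2) by (auto simp: star_verts_eq)
  have hub: "0 \<in> i 0" and self: "0 \<in> i x"
    using assms(1,3) x 0 False unfolding star_inv_def by blast+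
  have "0 \<in> i y" if y: "y \<in> {1..n}" for y
  proof (cases "y = x")
    case False
    have "i y = {y}" if "0 \<notin> i y"
      using assms(1) y that by (simp add: star_inv_def)
    moreover have "x \<in> i y"
      using assms(3) y by (simp add: star_verts_eq)
    ultimately show ?thesis
      using False by (metis singletonD)
  qed (simp add: self)
  with hub show ?thesis
    by (simp add: star_verts_eq)
qed (use assms in simp)

section \<open>Expected propagation times on the star\<close>

text \<open>The level is the number of leaves not yet selected: with \<open>j\<close> of them left, exactly \<open>j\<close> edges lower
  it. This is the coupon collector.\<close>

lemma expected_hub_time:
  assumes n: "1 \<le> n"
  shows "expected_time (star_edges n) (site_propagation_time (star_verts n) 0) = ennreal (n * harm n)"
proof -
  let ?\<delta> = "\<lambda>i e. exchange e i" and ?level = "\<lambda>i. card (uninformed n i)"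
  interpret level_chain "star_edges n" ?\<delta> "star_inv n" ?level "\<lambda>j. j"
  proof unfold_locales
    show "finite (star_edges n)" by (rule finite_star_edges)
    show "star_edges n \<noteq> {}" using n by (auto simp: star_edges_image)
    fix i e
    assume i: "star_inv n i"
    show "star_inv n (exchange e i)" if "e \<in> star_edges n"
      using i that by (rule star_inv_step_edge)
    fix l
    assume l: "card (uninformed n i) = Suc l"
    show "card (uninformed n (exchange e i)) = l \<or> card (uninformed n (exchange e i)) = Suc l"
      if "e \<in> star_edges n"
      using that
    proof (elim star_edgeE)
      fix w assume "e = {0, w}" "w \<in> {1..n}"
      then show ?thesis
        using l by (cases "w \<in> uninformed n i") (simp_all add: uninformed_exchange[OF i])
    qed
    have "card (uninformed n (exchange {0, x} i)) = l \<longleftrightarrow> x \<in> uninformed n i" if "x \<in> {1..n}" for x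
      using l by (cases "x \<in> uninformed n i") (simp_all add: uninformed_exchange[OF i that])
    moreover have "uninformed n i \<subseteq> {1..n}"
      by (simp add: uninformed_def subset_iff)
    ultimately have "{x \<in> {1..n}. card (uninformed n (exchange {0, x} i)) = l} = uninformed n i"
      by blast
    then show "card {e \<in> star_edges n. card (uninformed n (exchange e i)) = l} = Suc l"
      by (simp add: card_star_edges_filter l)
  qed
  have init: "?level (\<lambda>x. {x}) = n"
    by (simp add: uninformed_initial)
  have "expected_time (star_edges n) (site_propagation_time (star_verts n) 0) =
      (\<integral>\<^sup>+ \<omega>. ennreal_of_enat (hit (\<lambda>x. {x}) \<omega>) \<partial>\<Omega>)"
    unfolding expected_time_def edge_process_def
  proof (rule nn_integral_cong)
    fix \<omega> assume "\<omega> \<in> space \<Omega>"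
    then have "star_inv n (known \<omega> t)" for t
      using star_inv_known[OF n] by (simp add: edge_process_def)
    then show "ennreal_of_enat (site_propagation_time (star_verts n) 0 \<omega>) =
        ennreal_of_enat (hit (\<lambda>x. {x}) \<omega>)"
      by (simp add: site_propagation_time_def hit_def hub_known_iff known_eq_run)
  qed
  also have "\<dots> = ennreal (\<Sum>j=1..n. n / j)"
    using expected_hit[OF star_inv_initial[OF n]] by (simp add: init card_star_edges)
  also have "(\<Sum>j=1..n. n / j) = n * harm n"
    by (simp add: harm_def sum_distrib_left divide_inverse)
  finally show ?thesis .
qed

text \<open>Both phases of total propagation measured on one scale: in the first phase, the second one is
  counted in advance with its \<open>n - 1\<close> completions.\<close>

definition milestones_left :: "nat \<Rightarrow> (nat \<Rightarrow> nat set) \<Rightarrow> nat" where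
  "milestones_left n i =
     (if uninformed n i = {} then card (incomplete n i) else card (uninformed n i) + (n - 1))"

text \<open>The two branches of \<open>milestones_left\<close> fit together: the step that selects the last unselected leaf
  leaves \<open>n - 1\<close> incomplete leaves, which is one less than \<open>1 + (n - 1)\<close>.\<close>

lemma milestones_left_exchange:
  assumes inv: "star_inv n i" and w: "w \<in> {1..n}"
  shows "milestones_left n (exchange {0, w} i) = milestones_left n i -
     of_bool (w \<in> (if uninformed n i = {} then incomplete n i else uninformed n i))"
proof -
  have U: "uninformed n (exchange {0, w} i) = uninformed n i - {w}"
    by (rule uninformed_exchange[OF inv w])
  consider "uninformed n i = {}" | "uninformed n i = {w}" | "uninformed n i \<noteq> {}" "\<not> uninformed n i \<subseteq> {w}"
    by blast
  then show ?thesis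
  proof cases
    case 1
    then show ?thesis
      using incomplete_exchange[OF inv w]
      by (simp add: milestones_left_def U card_Diff_singleton_if)
  next
    case 2
    then show ?thesis
      using incomplete_exchange[OF inv w] incomplete_eq_leaves[OF inv] w
      by (simp add: milestones_left_def U card_Diff_singleton_if)
  next
    case 3
    then have "uninformed n i - {w} \<noteq> {}" "card (uninformed n i) > 0"
      by (auto simp: card_gt_0_iff)
    then show ?thesis
      using 3 by (simp add: milestones_left_def U card_Diff_singleton_if)
  qed
qed

text \<open>Thus levels below \<open>n\<close> belong to the second phase and all others to the first, which makes the
  number of descending edges a function of the level.\<close>

lemma card_incomplete_less:
  assumes "star_inv n i" "uninformed n i = {}"
  shows "card (incomplete n i) < n"
proof -
  have "incomplete n i \<subset> {1..n}"
    using assms by (simp add: star_inv_def incomplete_def psubset_eq subset_iff)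
  then show ?thesis
    using psubset_card_mono[of "{1..n}" "incomplete n i"] by simp
qed

lemma incomplete_empty_iff: "incomplete n i = {} \<longleftrightarrow> (\<forall>x\<in>{1..n}. star_verts n \<subseteq> i x)"
  unfolding incomplete_def by blast

lemma all_known_iff:
  assumes "star_inv n i"
  shows "(\<forall>y\<in>star_verts n. star_verts n \<subseteq> i y) \<longleftrightarrow> milestones_left n i = 0"
proof (cases "uninformed n i = {}")
  case True
  then show ?thesis
    using hub_complete[OF assms] star_verts_eq[of n]
    by (simp add: milestones_left_def incomplete_empty_iff)
next
  case False
  then have "milestones_left n i \<noteq> 0"
    by (simp add: milestones_left_def)
  moreover have "0 \<in> star_verts n"
    by (simp add: star_verts_def)
  ultimately show ?thesis
    using False hub_known_iff[OF assms] by blast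
qed

lemma sum_milestones:
  assumes "1 \<le> n"
  shows "(\<Sum>j=1..n + (n - 1). real n / real (if j < n then j else j - (n - 1))) = 2 * real n * harm n - 1"
proof -
  obtain m where m: "n = Suc m"
    using assms by (cases n) auto
  let ?f = "\<lambda>j. real n / real (if j < n then j else j - m)"
  have "sum ?f {1..m + n} = sum ?f {1..m} + sum ?f {m + 1..m + n}"
    by (rule sum.ub_add_nat) simp
  also have "sum ?f {1..m} = (\<Sum>j=1..m. n / j)"
    by (intro sum.cong refl) (simp add: m)
  also have "sum ?f {m + 1..m + n} = (\<Sum>k=1..n. ?f (k + m))"
    using sum.shift_bounds_cl_nat_ivl[of ?f 1 m n] by (simp only: add.commute)
  also have "\<dots> = (\<Sum>k=1..n. n / k)"
    by (intro sum.cong refl) (simp add: m)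
  also have "(\<Sum>j=1..m. n / j) + (\<Sum>k=1..n. n / k) = n * harm m + n * harm n"
    by (simp only: harm_def sum_distrib_left divide_inverse)
  also have "harm m = harm n - 1 / real n"
    unfolding m harm_Suc by (simp only: inverse_eq_divide)
  also have "n * (harm n - 1 / real n) + n * harm n = 2 * real n * harm n - 1"
    using assms by (simp add: right_diff_distrib)
  finally have "sum ?f {1..m + n} = 2 * real n * harm n - 1" .
  moreover have "n + (n - 1) = m + n" "n - 1 = m"
    by (simp_all add: m)
  ultimately show ?thesis
    by (simp only:)
qed

lemma expected_total_time:
  assumes n: "1 \<le> n"
  shows "expected_time (star_edges n) (total_propagation_time (star_verts n)) =
    ennreal (2 * real n * harm n - 1)"
proof -
  let ?\<delta> = "\<lambda>i e. exchange e i"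
  \<comment> \<open>In the second phase, at most \<open>n - 1\<close> leaves are left, and each of them lowers the level; in the
    first phase, the unselected leaves do, whose number is the level minus \<open>n - 1\<close>.\<close>
  let ?c = "\<lambda>j. if j < n then j else j - (n - 1)"
  interpret level_chain "star_edges n" ?\<delta> "star_inv n" "milestones_left n" ?c
  proof unfold_locales
    show "finite (star_edges n)" by (rule finite_star_edges)
    show "star_edges n \<noteq> {}" using n by (auto simp: star_edges_image)
    fix i e
    assume i: "star_inv n i"
    show "star_inv n (exchange e i)" if "e \<in> star_edges n"
      using i that by (rule star_inv_step_edge)
    fix l
    assume l: "milestones_left n i = Suc l"
    show "milestones_left n (exchange e i) = l \<or> milestones_left n (exchange e i) = Suc l"
      if "e \<in> star_edges n"
      using that
    proof (elim star_edgeE)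
      fix w assume "e = {0, w}" "w \<in> {1..n}"
      then show ?thesis
        by (simp only: milestones_left_exchange[OF i] l of_bool_def split: if_split) simp
    qed
    define G where "G = (if uninformed n i = {} then incomplete n i else uninformed n i)"
    have "G \<subseteq> {1..n}"
      by (simp add: G_def uninformed_def incomplete_def subset_iff)
    have "milestones_left n (exchange {0, x} i) = l \<longleftrightarrow> x \<in> G" if "x \<in> {1..n}" for x
      by (simp only: milestones_left_exchange[OF i that] l G_def[symmetric] of_bool_def split: if_split) simp
    with \<open>G \<subseteq> {1..n}\<close> have "{x \<in> {1..n}. milestones_left n (exchange {0, x} i) = l} = G"
      by blast
    moreover have "card G = ?c (Suc l)"
    proof (cases "uninformed n i = {}")
      case True
      then show ?thesis
        using l card_incomplete_less[OF i True] by (simp add: milestones_left_def G_def)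
    next
      case False
      then have "card (uninformed n i) > 0"
        by (simp add: card_gt_0_iff)
      then show ?thesis
        using l n False by (simp add: milestones_left_def G_def) linarith
    qed
    ultimately show "card {e \<in> star_edges n. milestones_left n (exchange e i) = l} = ?c (Suc l)"
      by (simp only: card_star_edges_filter)
  qed
  have init: "milestones_left n (\<lambda>x. {x}) = n + (n - 1)"
    using n by (simp add: uninformed_initial milestones_left_def)
  have "expected_time (star_edges n) (total_propagation_time (star_verts n)) =
      (\<integral>\<^sup>+ \<omega>. ennreal_of_enat (hit (\<lambda>x. {x}) \<omega>) \<partial>\<Omega>)"
    unfolding expected_time_def edge_process_def
  proof (rule nn_integral_cong)
    fix \<omega> assume "\<omega> \<in> space \<Omega>"
    then have "star_inv n (known \<omega> t)" for t
      using star_inv_known[OF n] by (simp add: edge_process_def)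
    then show "ennreal_of_enat (total_propagation_time (star_verts n) \<omega>) =
        ennreal_of_enat (hit (\<lambda>x. {x}) \<omega>)"
      by (simp add: total_propagation_time_def hit_def all_known_iff known_eq_run)
  qed
  also have "\<dots> = ennreal (\<Sum>j=1..n + (n - 1). n / ?c j)"
  proof -
    have "0 < ?c j \<and> ?c j \<le> n" if "1 \<le> j" "j \<le> n + (n - 1)" for j
      using that n by simp linarith
    then show ?thesis
      using expected_hit[OF star_inv_initial[OF n]] unfolding init card_star_edges by blast
  qed
  also have "(\<Sum>j=1..n + (n - 1). n / ?c j) = 2 * real n * harm n - 1"
    by (rule sum_milestones[OF n])
  finally show ?thesis .
qed

lemma min_expected_site_time:
  assumes n: "1 \<le> n"
  shows "(MIN x\<in>star_verts n. expected_time (star_edges n) (site_propagation_time (star_verts n) x)) =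
    ennreal (n * harm n)"
proof (rule Min_eqI)
  have "finite (star_verts n)"
    by (simp add: star_verts_def)
  then show "finite ((\<lambda>x. expected_time (star_edges n) (site_propagation_time (star_verts n) x)) ` star_verts n)"
    by (rule finite_imageI)
next
  show "ennreal (n * harm n) \<in>
      (\<lambda>x. expected_time (star_edges n) (site_propagation_time (star_verts n) x)) ` star_verts n"
    unfolding expected_hub_time[OF n, symmetric] by (rule imageI) (simp add: star_verts_def)
next
  fix u
  assume "u \<in> (\<lambda>x. expected_time (star_edges n) (site_propagation_time (star_verts n) x)) ` star_verts n"
  then obtain x where x: "x \<in> star_verts n"
    and u: "u = expected_time (star_edges n) (site_propagation_time (star_verts n) x)"
    by blast
  show "ennreal (n * harm n) \<le> u"
    unfolding u expected_hub_time[OF n, symmetric] expected_time_def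
  proof (rule nn_integral_mono)
    fix \<omega> assume \<omega>: "\<omega> \<in> space (edge_process (star_edges n))"
    have "site_propagation_time (star_verts n) 0 \<omega> \<le> site_propagation_time (star_verts n) x \<omega>"
      unfolding site_propagation_time_def first_time_def
      using leaf_known_imp_hub_known[OF star_inv_known[OF n \<omega>] x]
      by (intro Inf_superset_mono image_mono) blast
    then show "ennreal_of_enat (site_propagation_time (star_verts n) 0 \<omega>)
        \<le> ennreal_of_enat (site_propagation_time (star_verts n) x \<omega>)"
      by simp
  qed
qed

section \<open>The propagation ratio\<close>

lemma propagation_ratio_star:
  assumes n: "1 \<le> n"
  shows "propagation_ratio (star_verts n) (star_edges n) = ennreal (2 - 1 / (n * harm n))"
proof -
  have "1 \<le> (harm n :: real)"
    using harm_mono[of 1 n, where 'a = real] n by (simp add: harm_expand)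
  then have pos: "1 \<le> n * (harm n :: real)"
    using n mult_mono[of 1 "real n" 1 "harm n"] by simp
  define x where "x = n * (harm n :: real)"
  have "1 \<le> x"
    unfolding x_def by (rule pos)
  have "propagation_ratio (star_verts n) (star_edges n) = ennreal (2 * x - 1) / ennreal x"
    unfolding propagation_ratio_def expected_total_time[OF n] min_expected_site_time[OF n] x_def
    by (simp only: mult.assoc)
  also have "\<dots> = ennreal ((2 * x - 1) / x)"
    using \<open>1 \<le> x\<close> by (intro divide_ennreal) simp_all
  also have "(2 * x - 1) / x = 2 - 1 / x"
    using \<open>1 \<le> x\<close> by (simp add: diff_divide_distrib)
  finally show ?thesis
    unfolding x_def .
qed

theorem proposition1p4:
  shows "(\<lambda>n. propagation_ratio (star_verts n) (star_edges n)) \<longlonglongrightarrow> 2"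
proof -
  have "filterlim (\<lambda>n. real n * harm n) at_top sequentially"
    by (intro filterlim_at_top_mult_at_top filterlim_real_sequentially harm_at_top)
  then have "(\<lambda>n. 2 - 1 / (real n * harm n)) \<longlonglongrightarrow> 2 - 0"
    by (intro tendsto_diff tendsto_const tendsto_divide_0[OF tendsto_const])
       (rule filterlim_at_top_imp_at_infinity)
  then have "(\<lambda>n. ennreal (2 - 1 / (real n * harm n))) \<longlonglongrightarrow> ennreal 2"
    by (intro tendsto_ennrealI) simp
  moreover have "\<forall>\<^sub>F n in sequentially. ennreal (2 - 1 / (real n * harm n)) =
      propagation_ratio (star_verts n) (star_edges n)"
    using propagation_ratio_star by (intro eventually_sequentiallyI[of 1]) simp
  ultimately have "(\<lambda>n. propagation_ratio (star_verts n) (star_edges n)) \<longlonglongrightarrow> ennreal 2"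
    by (rule Lim_transform_eventually)
  then show ?thesis
    by simp
qed

end
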